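(* Let $\phi=\phi(\mathbf{x},t)$ be a (sufficiently regular) solution on $\Omega\times(0,T]$ of the nonlocal Cahn-Hilliard system $$\frac{\partial \phi}{\partial t}=-M\mathcal{L}\mu,\qquad \mu=F'(\phi)+\epsilon^2\mathcal{L}\phi .$$ Then the free energy $$E(\phi)=\int_{\Omega}\left(F(\phi(\mathbf{x}))+\frac{\epsilon^2}{4}\int_\Omega J(\mathbf{x}-\mathbf{y})\left[\phi(\mathbf{x})-\phi(\mathbf{y})\right]^2d\mathbf{y}\right)d\mathbf{x}$$ satisfies, along the solution, $$\frac{dE[\phi(t)]}{dt}=-(\mu,M\mathcal{L}\mu)\leq 0;$$ in particular $E$ is non-increasing in time.
   Context: $\Omega\subseteq\mathbb{R}^d$ is a bounded domain, $T>0$, $M>0$ is the mobility constant, $\epsilon>0$ is a constant, and $F$ is a continuously differentiable nonlinear potential with derivative $F'$. The kernel $J$ satisfies: $J(\mathbf{x})\ge 0$; $J(\mathbf{x}-\mathbf{y})=J(\mathbf{y}-\mathbf{x})$; and $J$ is $\Omega$-periodic. The nonlocal diffusion operator is $$\mathcal{L}u(\mathbf{x})=\int_{\Omega}J(\mathbf{x}-\mathbf{y})[u(\mathbf{x})-u(\mathbf{y})]\,d\mathbf{y},\qquad \mathbf{x}\in\Omega.$$ The inner product is $(u,v)=\int_\Omega uv\,d\mathbf{x}$. Sufficiently regular means that all integrals appearing (including those with $J$) converge, that the order of integration may be exchanged, and that differentiation in $t$ may be carried out under the integral sign. *)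

theory Defs
  imports "HOL-Analysis.Analysis"
begin

definition lattice_generated :: "'a::euclidean_space set \<Rightarrow> 'a set" where
  "lattice_generated B = {p. \<exists>k :: 'a \<Rightarrow> int. p = (\<Sum>b\<in>B. of_int (k b) *\<^sub>R b)}"

definition fundamental_domain :: "'a::euclidean_space set \<Rightarrow> 'a set \<Rightarrow> bool" where
  "fundamental_domain \<Lambda> \<Omega> \<longleftrightarrow>
     (\<forall>p\<in>\<Lambda>. p \<noteq> 0 \<longrightarrow> \<Omega> \<inter> (\<lambda>x. p + x) ` \<Omega> = {}) \<and>
     (\<Union>p\<in>\<Lambda>. (\<lambda>x. p + x) ` closure \<Omega>) = UNIV"

(* \<Omega>-periodicity presupposes that \<Omega> is a cell of some full-rank lattice of translations,
   e.g. an open box and the lattice generated by its edges. *)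
definition cell_periodic :: "'a::euclidean_space set \<Rightarrow> ('a \<Rightarrow> real) \<Rightarrow> bool" where
  "cell_periodic \<Omega> J \<longleftrightarrow>
     (\<exists>B. independent B \<and> span B = UNIV \<and> fundamental_domain (lattice_generated B) \<Omega> \<and>
          (\<forall>p\<in>lattice_generated B. \<forall>x. J (x + p) = J x))"

definition nonlocal_op :: "'a::euclidean_space set \<Rightarrow> ('a \<Rightarrow> real) \<Rightarrow> ('a \<Rightarrow> real) \<Rightarrow> 'a \<Rightarrow> real" where
  "nonlocal_op \<Omega> J u x = (LINT y:\<Omega>|lebesgue. J (x - y) * (u x - u y))"

definition inner_prod :: "'a::euclidean_space set \<Rightarrow> ('a \<Rightarrow> real) \<Rightarrow> ('a \<Rightarrow> real) \<Rightarrow> real" where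
  "inner_prod \<Omega> u v = (LINT x:\<Omega>|lebesgue. u x * v x)"

definition energy_density ::
  "'a::euclidean_space set \<Rightarrow> ('a \<Rightarrow> real) \<Rightarrow> (real \<Rightarrow> real) \<Rightarrow> real \<Rightarrow> ('a \<Rightarrow> real) \<Rightarrow> 'a \<Rightarrow> real" where
  "energy_density \<Omega> J F \<epsilon> u x =
     F (u x) + \<epsilon>\<^sup>2 / 4 * (LINT y:\<Omega>|lebesgue. J (x - y) * (u x - u y)\<^sup>2)"

definition free_energy ::
  "'a::euclidean_space set \<Rightarrow> ('a \<Rightarrow> real) \<Rightarrow> (real \<Rightarrow> real) \<Rightarrow> real \<Rightarrow> ('a \<Rightarrow> real) \<Rightarrow> real" where
  "free_energy \<Omega> J F \<epsilon> u = (LINT x:\<Omega>|lebesgue. energy_density \<Omega> J F \<epsilon> u x)"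

(* \<phi> t, \<phi>t t and \<mu> t are the spatial profiles at time t, and \<phi>t is the time derivative of \<phi>.
   Differentiating within {0<..T} is one-sided at t = T and the usual derivative at 0 < t < T. *)
definition nonlocal_CH_solution ::
  "'a::euclidean_space set \<Rightarrow> ('a \<Rightarrow> real) \<Rightarrow> (real \<Rightarrow> real) \<Rightarrow> real \<Rightarrow> real \<Rightarrow> real \<Rightarrow>
   (real \<Rightarrow> 'a \<Rightarrow> real) \<Rightarrow> (real \<Rightarrow> 'a \<Rightarrow> real) \<Rightarrow> (real \<Rightarrow> 'a \<Rightarrow> real) \<Rightarrow> bool" where
  "nonlocal_CH_solution \<Omega> J F' M \<epsilon> T \<phi> \<phi>t \<mu> \<longleftrightarrow>
     (\<forall>t\<in>{0<..T}. \<forall>x\<in>\<Omega>.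
        ((\<lambda>s. \<phi> s x) has_real_derivative \<phi>t t x) (at t within {0<..T}) \<and>
        \<phi>t t x = - M * nonlocal_op \<Omega> J (\<mu> t) x \<and>
        \<mu> t x = F' (\<phi> t x) + \<epsilon>\<^sup>2 * nonlocal_op \<Omega> J (\<phi> t) x)"

(* Inner integrals are only required to converge almost everywhere, as in Fubini's theorem. *)
definition exchangeable :: "'a::euclidean_space set \<Rightarrow> ('a \<Rightarrow> 'a \<Rightarrow> real) \<Rightarrow> bool" where
  "exchangeable \<Omega> k \<longleftrightarrow>
     (AE x\<in>\<Omega> in lebesgue. set_integrable lebesgue \<Omega> (\<lambda>y. k x y)) \<and>
     (AE y\<in>\<Omega> in lebesgue. set_integrable lebesgue \<Omega> (\<lambda>x. k x y)) \<and>
     set_integrable lebesgue \<Omega> (\<lambda>x. LINT y:\<Omega>|lebesgue. k x y) \<and>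
     set_integrable lebesgue \<Omega> (\<lambda>y. LINT x:\<Omega>|lebesgue. k x y) \<and>
     (LINT x:\<Omega>|lebesgue. (LINT y:\<Omega>|lebesgue. k x y)) =
     (LINT y:\<Omega>|lebesgue. (LINT x:\<Omega>|lebesgue. k x y))"

definition differentiable_under_integral ::
  "'a::euclidean_space set \<Rightarrow> real set \<Rightarrow> real \<Rightarrow> (real \<Rightarrow> 'a \<Rightarrow> real) \<Rightarrow> bool" where
  "differentiable_under_integral \<Omega> S t f \<longleftrightarrow>
     (\<exists>f'. (\<forall>x\<in>\<Omega>. ((\<lambda>s. f s x) has_real_derivative f' x) (at t within S)) \<and>
           set_integrable lebesgue \<Omega> f' \<and>
           ((\<lambda>s. LINT x:\<Omega>|lebesgue. f s x) has_real_derivative (LINT x:\<Omega>|lebesgue. f' x))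
             (at t within S))"

(* In order: convergence of the integrals; exchange of the order of integration in the double
   integrals (L \<phi>, \<phi>t) and (L \<mu>, \<mu>); differentiation in t under the inner and the outer
   integral of the energy. *)
definition sufficiently_regular ::
  "'a::euclidean_space set \<Rightarrow> ('a \<Rightarrow> real) \<Rightarrow> (real \<Rightarrow> real) \<Rightarrow> real \<Rightarrow> real \<Rightarrow>
   (real \<Rightarrow> 'a \<Rightarrow> real) \<Rightarrow> (real \<Rightarrow> 'a \<Rightarrow> real) \<Rightarrow> (real \<Rightarrow> 'a \<Rightarrow> real) \<Rightarrow> bool" where
  "sufficiently_regular \<Omega> J F \<epsilon> T \<phi> \<phi>t \<mu> \<longleftrightarrow>
     (\<forall>t\<in>{0<..T}.
        (\<forall>x\<in>\<Omega>. set_integrable lebesgue \<Omega> (\<lambda>y. J (x - y) * (\<phi> t x - \<phi> t y)) \<and>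
               set_integrable lebesgue \<Omega> (\<lambda>y. J (x - y) * (\<mu> t x - \<mu> t y)) \<and>
               set_integrable lebesgue \<Omega> (\<lambda>y. J (x - y) * (\<phi> t x - \<phi> t y)\<^sup>2)) \<and>
        set_integrable lebesgue \<Omega> (energy_density \<Omega> J F \<epsilon> (\<phi> t)) \<and>
        set_integrable lebesgue \<Omega> (\<lambda>x. \<mu> t x * nonlocal_op \<Omega> J (\<mu> t) x) \<and>
        exchangeable \<Omega> (\<lambda>x y. J (x - y) * (\<phi> t x - \<phi> t y) * \<phi>t t x) \<and>
        exchangeable \<Omega> (\<lambda>x y. J (x - y) * (\<mu> t x - \<mu> t y) * \<mu> t x) \<and>
        (\<forall>x\<in>\<Omega>. differentiable_under_integral \<Omega> {0<..T} t
                 (\<lambda>s y. J (x - y) * (\<phi> s x - \<phi> s y)\<^sup>2)) \<and>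
        differentiable_under_integral \<Omega> {0<..T} t (\<lambda>s x. energy_density \<Omega> J F \<epsilon> (\<phi> s) x))"

end

(* Differentiating under both integrals gives
     dE/dt = int F'(u) v + (eps^2 / 2) int int J(x - y) (u x - u y) (v x - v y)
   with u = phi and v = d phi / dt.  By the symmetry of J, exchanging the order of integration
   turns the double integral into 2 (L u, v), so dE/dt = (mu, v) = - M (mu, L mu).  The same
   symmetrization gives 2 (mu, L mu) = int int J(x - y) (mu x - mu y)^2, which is nonnegative. *)
theory Submission
  imports Defs
begin

text \<open>\<open>differentiable_under_integral\<close> supplies some pointwise derivative through
  an existential. Derivatives are unique when the filter at \<open>t\<close> within \<open>S\<close>
  is nontrivial, so on \<Omega> it can be replaced by any derivative \<open>f'\<close> computed
  explicitly.\<close>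

lemma differentiable_under_integralD:
  assumes "differentiable_under_integral \<Omega> S t f" "\<Omega> \<in> sets lebesgue"
    and "at t within S \<noteq> bot"
    and f': "\<And>x. x \<in> \<Omega> \<Longrightarrow> ((\<lambda>s. f s x) has_real_derivative f' x) (at t within S)"
  shows "set_integrable lebesgue \<Omega> f'"
    and "((\<lambda>s. LINT x:\<Omega>|lebesgue. f s x) has_real_derivative (LINT x:\<Omega>|lebesgue. f' x))
           (at t within S)"
proof -
  obtain g where g: "\<And>x. x \<in> \<Omega> \<Longrightarrow> ((\<lambda>s. f s x) has_real_derivative g x) (at t within S)"
      "set_integrable lebesgue \<Omega> g"
      "((\<lambda>s. LINT x:\<Omega>|lebesgue. f s x) has_real_derivative (LINT x:\<Omega>|lebesgue. g x))
         (at t within S)"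
    using assms(1) unfolding differentiable_under_integral_def by blast
  have eq: "g x = f' x" if "x \<in> \<Omega>" for x
    using has_field_derivative_unique[OF g(1)[OF that] f'[OF that] assms(3)] .
  show "set_integrable lebesgue \<Omega> f'"
    using g(2) by (rule back_subst) (rule set_integrable_cong; simp add: eq)
  have "(LINT x:\<Omega>|lebesgue. g x) = (LINT x:\<Omega>|lebesgue. f' x)"
    using assms(2) by (intro set_lebesgue_integral_cong) (auto simp: eq)
  then show "((\<lambda>s. LINT x:\<Omega>|lebesgue. f s x) has_real_derivative (LINT x:\<Omega>|lebesgue. f' x))
           (at t within S)"
    using g(3) by simp
qed

text \<open>Non-integrable \<open>f\<close> are covered as well, since their Bochner integral is 0
  by default.\<close>

lemma set_lebesgue_integral_nonneg_AE:
  fixes f :: "'a \<Rightarrow> real"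
  assumes "AE x\<in>A in M. 0 \<le> f x"
  shows "0 \<le> (LINT x:A|M. f x)"
  unfolding set_lebesgue_integral_def using assms
  by (intro integral_nonneg_AE) (auto simp: indicator_def elim: eventually_mono)

text \<open>The second summand of \<open>h\<close> is the inner integral of the transposed kernel;
  exchanging the order of integration gives both summands the same outer integral, hence the factor
  2. Slices are integrable only almost everywhere, so the two inner integrals merge into one only
  almost everywhere.\<close>

lemma exchangeable_symmetrize:
  assumes "exchangeable \<Omega> k"
  defines "h \<equiv> \<lambda>x. (LINT y:\<Omega>|lebesgue. k x y) + (LINT y:\<Omega>|lebesgue. k y x)"
  shows "set_integrable lebesgue \<Omega> h"
    and "(LINT x:\<Omega>|lebesgue. h x) = 2 * (LINT x:\<Omega>|lebesgue. (LINT y:\<Omega>|lebesgue. k x y))"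
    and "AE x\<in>\<Omega> in lebesgue. h x = (LINT y:\<Omega>|lebesgue. k x y + k y x)"
proof -
  have int: "set_integrable lebesgue \<Omega> (\<lambda>x. LINT y:\<Omega>|lebesgue. k x y)"
      "set_integrable lebesgue \<Omega> (\<lambda>x. LINT y:\<Omega>|lebesgue. k y x)"
    and swap: "(LINT x:\<Omega>|lebesgue. (LINT y:\<Omega>|lebesgue. k y x)) =
      (LINT x:\<Omega>|lebesgue. (LINT y:\<Omega>|lebesgue. k x y))"
    and slices: "AE x\<in>\<Omega> in lebesgue. set_integrable lebesgue \<Omega> (\<lambda>y. k x y)"
      "AE x\<in>\<Omega> in lebesgue. set_integrable lebesgue \<Omega> (\<lambda>y. k y x)"
    using assms(1) unfolding exchangeable_def by simp_all
  show "set_integrable lebesgue \<Omega> h"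
    unfolding h_def using int by (rule set_integral_add)
  show "(LINT x:\<Omega>|lebesgue. h x) = 2 * (LINT x:\<Omega>|lebesgue. (LINT y:\<Omega>|lebesgue. k x y))"
    unfolding h_def using set_integral_add(2)[OF int] swap by simp
  show "AE x\<in>\<Omega> in lebesgue. h x = (LINT y:\<Omega>|lebesgue. k x y + k y x)"
    using slices by eventually_elim (auto simp: h_def)
qed

text \<open>This is the quadratic case \<open>v = u\<close> of the Dirichlet form. It is applied to
  \<mu>, for which \<open>sufficiently_regular\<close> does not assert that the squared differences
  are integrable at every point; the almost-everywhere symmetrization still determines the
  sign.\<close>

lemma inner_prod_nonlocal_op_nonneg:
  assumes "\<And>x. J x \<ge> 0" and J: "\<And>x y. J (x - y) = J (y - x)"
    and ex: "exchangeable \<Omega> (\<lambda>x y. J (x - y) * (u x - u y) * u x)"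
  shows "0 \<le> inner_prod \<Omega> u (nonlocal_op \<Omega> J u)"
proof -
  define k where "k x y = J (x - y) * (u x - u y) * u x" for x y
  note sym = exchangeable_symmetrize[OF ex, folded k_def]
  have "k x y + k y x = J (x - y) * (u x - u y)\<^sup>2" for x y
    unfolding k_def using J[of x y] by (simp add: algebra_simps power2_eq_square)
  then have "0 \<le> k x y + k y x" for x y
    using assms(1) by simp
  then have "0 \<le> (LINT y:\<Omega>|lebesgue. k x y + k y x)" for x
    by (intro set_lebesgue_integral_nonneg_AE) simp
  then have "AE x\<in>\<Omega> in lebesgue.
      0 \<le> (LINT y:\<Omega>|lebesgue. k x y) + (LINT y:\<Omega>|lebesgue. k y x)"
    using sym(3) by (auto elim: eventually_mono)
  then have "0 \<le> 2 * (LINT x:\<Omega>|lebesgue. (LINT y:\<Omega>|lebesgue. k x y))"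
    unfolding sym(2)[symmetric] by (rule set_lebesgue_integral_nonneg_AE)
  moreover have "(LINT y:\<Omega>|lebesgue. k x y) = u x * nonlocal_op \<Omega> J u x" for x
    unfolding k_def nonlocal_op_def by (simp add: mult.commute)
  ultimately show ?thesis
    by (simp add: inner_prod_def)
qed

text \<open>The slice hypotheses hold at every point rather than almost everywhere, which avoids having
  to show that the inner integral is measurable in \<open>x\<close>.\<close>
lemma nonlocal_dirichlet_form:
  assumes \<Omega>: "\<Omega> \<in> sets lebesgue"
    and J: "\<And>x y. J (x - y) = J (y - x)"
    and u: "\<And>x. x \<in> \<Omega> \<Longrightarrow> set_integrable lebesgue \<Omega> (\<lambda>y. J (x - y) * (u x - u y))"
    and uv: "\<And>x. x \<in> \<Omega> \<Longrightarrow>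
      set_integrable lebesgue \<Omega> (\<lambda>y. J (x - y) * (u x - u y) * (v x - v y))"
    and ex: "exchangeable \<Omega> (\<lambda>x y. J (x - y) * (u x - u y) * v x)"
  defines "D \<equiv> \<lambda>x. LINT y:\<Omega>|lebesgue. J (x - y) * (u x - u y) * (v x - v y)"
  shows "set_integrable lebesgue \<Omega> (\<lambda>x. v x * nonlocal_op \<Omega> J u x)"
    and "set_integrable lebesgue \<Omega> D"
    and "(LINT x:\<Omega>|lebesgue. D x) = 2 * (LINT x:\<Omega>|lebesgue. v x * nonlocal_op \<Omega> J u x)"
proof -
  define k where "k x y = J (x - y) * (u x - u y) * v x" for x y
  note ex = ex[folded k_def]
  have Lk: "(LINT y:\<Omega>|lebesgue. k x y) = v x * nonlocal_op \<Omega> J u x" for x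
    unfolding k_def nonlocal_op_def by (simp add: mult.commute)
  show "set_integrable lebesgue \<Omega> (\<lambda>x. v x * nonlocal_op \<Omega> J u x)"
    using ex unfolding exchangeable_def Lk by blast
  \<comment> \<open>Swapping \<open>x\<close> and \<open>y\<close> flips the sign of
    \<open>u x - u y\<close> and preserves \<open>J\<close>, so the two \<open>v\<close> factors
    combine into a difference.\<close>
  have kk: "J (x - y) * (u x - u y) * (v x - v y) = k x y + k y x" for x y
    unfolding k_def using J[of x y] by (simp add: algebra_simps)
  have eq: "(LINT y:\<Omega>|lebesgue. k x y) + (LINT y:\<Omega>|lebesgue. k y x) = D x" if "x \<in> \<Omega>" for x
  proof -
    have k1: "set_integrable lebesgue \<Omega> (\<lambda>y. k x y)"
      unfolding k_def using u[OF that] by simp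
    \<comment> \<open>In the transposed slice \<open>v y\<close> varies under the integral, so
      \<open>u\<close> alone does not control it. It is recovered by subtracting
      \<open>k x y\<close> from the symmetrized integrand, which \<open>uv\<close> makes
      integrable.\<close>
    have "set_integrable lebesgue \<Omega> (\<lambda>y. (k x y + k y x) - k x y)"
      using uv[OF that] k1 unfolding kk by (rule set_integral_diff)
    then have "set_integrable lebesgue \<Omega> (\<lambda>y. k y x)"
      by simp
    with k1 show ?thesis
      unfolding D_def kk by simp
  qed
  note sym = exchangeable_symmetrize[OF ex]
  show "set_integrable lebesgue \<Omega> D"
    using sym(1) by (rule back_subst) (rule set_integrable_cong; simp add: eq)
  have "(LINT x:\<Omega>|lebesgue. D x) =
      (LINT x:\<Omega>|lebesgue. (LINT y:\<Omega>|lebesgue. k x y) + (LINT y:\<Omega>|lebesgue. k y x))"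
    using \<Omega> by (intro set_lebesgue_integral_cong) (auto simp: eq)
  then show "(LINT x:\<Omega>|lebesgue. D x) = 2 * (LINT x:\<Omega>|lebesgue. v x * nonlocal_op \<Omega> J u x)"
    using sym(2) by (simp add: Lk)
qed

text \<open>The chemical potential is the L2 gradient of the energy, so this is the chain rule along
  an arbitrary path with velocity \<open>v\<close>. The evolution equation enters only when
  \<open>v\<close> is substituted in the theorem.\<close>

lemma free_energy_has_derivative:
  assumes \<Omega>: "\<Omega> \<in> sets lebesgue"
    and F: "\<And>r. (F has_real_derivative F' r) (at r)"
    and J: "\<And>x y. J (x - y) = J (y - x)"
    and S: "at t within S \<noteq> bot"
    and \<phi>t: "\<And>x. x \<in> \<Omega> \<Longrightarrow> ((\<lambda>s. \<phi> s x) has_real_derivative v x) (at t within S)"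
    and int: "\<And>x. x \<in> \<Omega> \<Longrightarrow> set_integrable lebesgue \<Omega> (\<lambda>y. J (x - y) * (\<phi> t x - \<phi> t y))"
    and ex: "exchangeable \<Omega> (\<lambda>x y. J (x - y) * (\<phi> t x - \<phi> t y) * v x)"
    and inner: "\<And>x. x \<in> \<Omega> \<Longrightarrow>
      differentiable_under_integral \<Omega> S t (\<lambda>s y. J (x - y) * (\<phi> s x - \<phi> s y)\<^sup>2)"
    and outer: "differentiable_under_integral \<Omega> S t (\<lambda>s x. energy_density \<Omega> J F \<epsilon> (\<phi> s) x)"
  shows "((\<lambda>s. free_energy \<Omega> J F \<epsilon> (\<phi> s)) has_real_derivative
           inner_prod \<Omega> v (\<lambda>x. F' (\<phi> t x) + \<epsilon>\<^sup>2 * nonlocal_op \<Omega> J (\<phi> t) x)) (at t within S)"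
proof -
  define u where "u = \<phi> t"
  define D where "D x = (LINT y:\<Omega>|lebesgue. J (x - y) * (u x - u y) * (v x - v y))" for x
  let ?L = "\<lambda>x. v x * nonlocal_op \<Omega> J u x"
  have inner': "((\<lambda>s. J (x - y) * (\<phi> s x - \<phi> s y)\<^sup>2) has_real_derivative
      2 * (J (x - y) * (u x - u y) * (v x - v y))) (at t within S)"
    if "x \<in> \<Omega>" "y \<in> \<Omega>" for x y
    using \<phi>t[OF that(1)] \<phi>t[OF that(2)] unfolding u_def
    by (auto intro!: derivative_eq_intros)
  note dui = differentiable_under_integralD[OF inner \<Omega> S inner']
  \<comment> \<open>Differentiation under the inner integral includes integrability of the
    differentiated integrand, which is the slice hypothesis of
    \<open>nonlocal_dirichlet_form\<close>.\<close>
  have uv: "set_integrable lebesgue \<Omega> (\<lambda>y. J (x - y) * (u x - u y) * (v x - v y))"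
    if "x \<in> \<Omega>" for x
    using dui(1)[OF that that] by simp
  \<comment> \<open>The square contributes a factor 2, turning \<open>\<epsilon>\<^sup>2 / 4\<close>
    into \<open>\<epsilon>\<^sup>2 / 2\<close>; the factor 2 in \<open>dir(3)\<close> later restores
    the full \<open>\<epsilon>\<^sup>2\<close> of the chemical potential.\<close>
  have dens: "((\<lambda>s. energy_density \<Omega> J F \<epsilon> (\<phi> s) x) has_real_derivative
      F' (u x) * v x + \<epsilon>\<^sup>2 / 2 * D x) (at t within S)" if x: "x \<in> \<Omega>" for x
  proof -
    have "((\<lambda>s. F (\<phi> s x)) has_real_derivative F' (u x) * v x) (at t within S)"
      unfolding u_def using DERIV_chain2[OF F \<phi>t[OF x]] .
    moreover have "((\<lambda>s. \<epsilon>\<^sup>2 / 4 * (LINT y:\<Omega>|lebesgue. J (x - y) * (\<phi> s x - \<phi> s y)\<^sup>2))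
        has_real_derivative \<epsilon>\<^sup>2 / 4 * (2 * D x)) (at t within S)"
      using DERIV_cmult[OF dui(2)[OF x x], of "\<epsilon>\<^sup>2 / 4"] unfolding D_def
      by (simp only: set_integral_mult_right)
    ultimately show ?thesis
      unfolding energy_density_def by (auto dest: DERIV_add simp: mult.commute)
  qed
  note outerD = differentiable_under_integralD[OF outer \<Omega> S dens]
  note dir = nonlocal_dirichlet_form[OF \<Omega> J int[folded u_def] uv ex[folded u_def],
      folded D_def]
  have Dint: "set_integrable lebesgue \<Omega> (\<lambda>x. \<epsilon>\<^sup>2 / 2 * D x)"
    using dir(2) by simp
  \<comment> \<open>Regularity gives integrability only of the whole differentiated density.
    Removing the nonlocal part isolates the local term, so that the integral can be split.\<close>
  have "set_integrable lebesgue \<Omega> (\<lambda>x. (F' (u x) * v x + \<epsilon>\<^sup>2 / 2 * D x) - \<epsilon>\<^sup>2 / 2 * D x)"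
    using outerD(1) Dint by (rule set_integral_diff)
  then have Fint: "set_integrable lebesgue \<Omega> (\<lambda>x. F' (u x) * v x)"
    by simp
  have "(LINT x:\<Omega>|lebesgue. F' (u x) * v x + \<epsilon>\<^sup>2 / 2 * D x)
      = (LINT x:\<Omega>|lebesgue. F' (u x) * v x) + (LINT x:\<Omega>|lebesgue. \<epsilon>\<^sup>2 * ?L x)"
    using set_integral_add(2)[OF Fint Dint] dir(3) by simp
  also have "\<dots> = (LINT x:\<Omega>|lebesgue. F' (u x) * v x + \<epsilon>\<^sup>2 * ?L x)"
    using Fint dir(1) by simp
  also have "\<dots> = inner_prod \<Omega> v (\<lambda>x. F' (u x) + \<epsilon>\<^sup>2 * nonlocal_op \<Omega> J u x)"
    unfolding inner_prod_def by (simp add: algebra_simps)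
  finally show ?thesis
    using outerD(2) unfolding free_energy_def u_def by simp
qed

text \<open>At \<open>a\<close> and \<open>b\<close> the derivative within \<open>S\<close> may be
  one-sided, but the mean value argument asks only for continuity there. Points strictly between are
  interior to \<open>S\<close>, where the derivative is two-sided.\<close>

lemma nonincreasing_if_has_nonpos_derivative_within:
  fixes f :: "real \<Rightarrow> real"
  assumes "a \<le> b" "{a..b} \<subseteq> S"
    and f': "\<And>x. x \<in> S \<Longrightarrow> (f has_real_derivative f' x) (at x within S) \<and> f' x \<le> 0"
  shows "f b \<le> f a"
proof (rule DERIV_nonpos_imp_decreasing_open[OF assms(1)])
  show "\<exists>y. DERIV f x :> y \<and> y \<le> 0" if "a < x" "x < b" for x
  proof -
    have "{a<..<b} \<subseteq> S"
      using assms(2) by auto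
    then have "x \<in> interior S"
      using that by (intro interiorI[of "{a<..<b}"]) auto
    then show ?thesis
      using f'[of x] at_within_interior[of x S] interior_subset[of S] by auto
  qed
  have "continuous_on S f"
    using f' by (intro DERIV_continuous_on) blast
  then show "continuous_on {a..b} f"
    using assms(2) continuous_on_subset by blast
qed

theorem mainTheorem1:
  fixes \<Omega> :: "'a::euclidean_space set"
    and J :: "'a \<Rightarrow> real"
    and F F' :: "real \<Rightarrow> real"
    and M \<epsilon> T :: real
    and \<phi> \<phi>t \<mu> :: "real \<Rightarrow> 'a \<Rightarrow> real"
  assumes "open \<Omega>" "connected \<Omega>" "bounded \<Omega>" "\<Omega> \<noteq> {}"
    and "T > 0" "M > 0" "\<epsilon> > 0"
    and "\<And>r. (F has_real_derivative F' r) (at r)" "continuous_on UNIV F'"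
    and "\<And>x. J x \<ge> 0" "\<And>x y. J (x - y) = J (y - x)" "cell_periodic \<Omega> J"
    and "nonlocal_CH_solution \<Omega> J F' M \<epsilon> T \<phi> \<phi>t \<mu>"
    and "sufficiently_regular \<Omega> J F \<epsilon> T \<phi> \<phi>t \<mu>"
  shows "(\<forall>t\<in>{0<..T}.
            ((\<lambda>s. free_energy \<Omega> J F \<epsilon> (\<phi> s)) has_real_derivative
               - inner_prod \<Omega> (\<mu> t) (\<lambda>x. M * nonlocal_op \<Omega> J (\<mu> t) x)) (at t within {0<..T}) \<and>
            - inner_prod \<Omega> (\<mu> t) (\<lambda>x. M * nonlocal_op \<Omega> J (\<mu> t) x) \<le> 0) \<and>
         (\<forall>s t. 0 < s \<and> s \<le> t \<and> t \<le> T \<longrightarrow>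
            free_energy \<Omega> J F \<epsilon> (\<phi> t) \<le> free_energy \<Omega> J F \<epsilon> (\<phi> s))"
proof -
  note J = assms(10,11)
  have \<Omega>: "\<Omega> \<in> sets lebesgue"
    using \<open>open \<Omega>\<close> by (simp add: borel_open)
  note sol = assms(13)[unfolded nonlocal_CH_solution_def]
  note reg = assms(14)[unfolded sufficiently_regular_def]
  have main: "((\<lambda>s. free_energy \<Omega> J F \<epsilon> (\<phi> s)) has_real_derivative
        - inner_prod \<Omega> (\<mu> t) (\<lambda>x. M * nonlocal_op \<Omega> J (\<mu> t) x)) (at t within {0<..T}) \<and>
      - inner_prod \<Omega> (\<mu> t) (\<lambda>x. M * nonlocal_op \<Omega> J (\<mu> t) x) \<le> 0" if t: "t \<in> {0<..T}" for t
  proof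
    \<comment> \<open>Approaching from the left also covers the endpoint
      \<open>t = T\<close>.\<close>
    have "t islimpt {0<..<t}"
      using t by (intro islimpt_greaterThanLessThan2) simp
    then have "t islimpt {0<..T}"
      by (rule islimpt_subset) (use t in auto)
    then have S: "at t within {0<..T} \<noteq> bot"
      by (simp add: trivial_limit_within)
    have "((\<lambda>s. free_energy \<Omega> J F \<epsilon> (\<phi> s)) has_real_derivative
        inner_prod \<Omega> (\<phi>t t) (\<lambda>x. F' (\<phi> t x) + \<epsilon>\<^sup>2 * nonlocal_op \<Omega> J (\<phi> t) x))
        (at t within {0<..T})"
      using sol reg t by (intro free_energy_has_derivative \<Omega> assms(8) J(2) S) blast+
    \<comment> \<open>Both equations of the system are used here: one replaces the velocity, the
      other identifies the gradient with \<open>\<mu> t\<close>. They hold on \<Omega> only, hence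
      the congruence under the set integral.\<close>
    moreover have "inner_prod \<Omega> (\<phi>t t) (\<lambda>x. F' (\<phi> t x) + \<epsilon>\<^sup>2 * nonlocal_op \<Omega> J (\<phi> t) x)
        = (LINT x:\<Omega>|lebesgue. - (\<mu> t x * (M * nonlocal_op \<Omega> J (\<mu> t) x)))"
      unfolding inner_prod_def using \<Omega>
    proof (rule set_lebesgue_integral_cong, intro allI impI)
      fix x assume "x \<in> \<Omega>"
      with sol t have "\<phi>t t x = - M * nonlocal_op \<Omega> J (\<mu> t) x"
          "F' (\<phi> t x) + \<epsilon>\<^sup>2 * nonlocal_op \<Omega> J (\<phi> t) x = \<mu> t x"
        by auto
      then show "\<phi>t t x * (F' (\<phi> t x) + \<epsilon>\<^sup>2 * nonlocal_op \<Omega> J (\<phi> t) x)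
          = - (\<mu> t x * (M * nonlocal_op \<Omega> J (\<mu> t) x))"
        by simp
    qed
    moreover have "\<dots> = - inner_prod \<Omega> (\<mu> t) (\<lambda>x. M * nonlocal_op \<Omega> J (\<mu> t) x)"
      unfolding inner_prod_def set_lebesgue_integral_def by simp
    ultimately show "((\<lambda>s. free_energy \<Omega> J F \<epsilon> (\<phi> s)) has_real_derivative
        - inner_prod \<Omega> (\<mu> t) (\<lambda>x. M * nonlocal_op \<Omega> J (\<mu> t) x)) (at t within {0<..T})"
      by simp
    have "0 \<le> inner_prod \<Omega> (\<mu> t) (nonlocal_op \<Omega> J (\<mu> t))"
      using reg t by (intro inner_prod_nonlocal_op_nonneg J) blast
    moreover have "inner_prod \<Omega> (\<mu> t) (\<lambda>x. M * nonlocal_op \<Omega> J (\<mu> t) x)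
        = M * inner_prod \<Omega> (\<mu> t) (nonlocal_op \<Omega> J (\<mu> t))"
      unfolding inner_prod_def by (simp add: mult.left_commute)
    ultimately show "- inner_prod \<Omega> (\<mu> t) (\<lambda>x. M * nonlocal_op \<Omega> J (\<mu> t) x) \<le> 0"
      using \<open>M > 0\<close> by simp
  qed
  have "free_energy \<Omega> J F \<epsilon> (\<phi> t) \<le> free_energy \<Omega> J F \<epsilon> (\<phi> s)" if "0 < s" "s \<le> t" "t \<le> T" for s t
    using that
    by (intro nonincreasing_if_has_nonpos_derivative_within
        [where S = "{0<..T}" and f = "\<lambda>s. free_energy \<Omega> J F \<epsilon> (\<phi> s)", OF _ _ main]) auto
  with main show ?thesis
    by blast
qed

end
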